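(* Let $2\le k\le n$ be integers and let $k=\prod_{j=1}^{\sigma}p_j$ be a factorization of $k$ into positive integers with $p_1\ge p_2\ge\cdots\ge p_\sigma$. The exact number of basic arithmetic operations demanded by Algorithm 2 (described in the context), which computes the partial exponential Bell polynomial $B_{n,k}(x)$, is $$Q^{(2)}_{n,k}=a(k)n^2+b(k)n+c(k),$$ where $$a(k)=\sum_{j=1}^{\sigma}p_j,\qquad b(k)=2+2\sum_{j=1}^{\sigma}\Big(j-\sum_{m=1}^{j}p_m\Big)p_j,$$ $$c(k)=\sum_{j=1}^{\sigma}\Big(j-\sum_{m=1}^{j}p_m\Big)^2p_j-\sum_{j=1}^{\sigma}p_j+2\sigma.$$
   Context: For a real sequence $x$, the partial exponential Bell polynomial is $B_{n,k}(x)=\sum \frac{n!}{j_1!\cdots j_n!}\prod_{i=1}^n (x_i/i!)^{j_i}$, summed over nonnegative integers with $\sum_i j_i=k$, $\sum_i i j_i=n$. The partial ordinary Bell polynomial is $\hat{B}_{n,k}(x)=\frac{k!}{n!}B_{n,k}(\tilde x)$ with $\tilde x_m=m!\,x_m$. Algorithm 2 (given $n$, $k$, the factors $p_1,\ldots,p_\sigma$, and $x_1,\ldots,x_n$): 1. Set $y_i\gets x_i/i!$ for $i=1,\ldots,n+\sigma-\sum_{m=1}^{\sigma}p_m$. 2. For $j=1,2,\ldots,\sigma$ do: (a) Calculate $r_j\gets\sum_{m=1}^{\sigma-j+1}p_m$. (b) Initiate $\hat{B}_{0,0}(y)=1$ and $\hat{B}_{i,0}(y)=0$ for $i=1,\ldots,n-r_j+\sigma-j$.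 (c) For $l=1,\ldots,p_{\sigma-j+1}$ do: for $i=l,l+1,\ldots,l+n+\sigma-j-r_j$ do: $\hat{B}_{i,l}(y)\gets\sum_{m=1}^{i-l+1}y_m\,\hat{B}_{i-m,l-1}(y)$. (d) Set $y_l\gets 0$ for $l=1,\ldots,p_{\sigma-j+1}-1$, and $y_l\gets\hat{B}_{l,p_{\sigma-j+1}}(y)$ (the values computed in (c)) for $l=p_{\sigma-j+1},\ldots,n-r_j+p_{\sigma-j+1}+\sigma-j$. 3. Set $B_{n,k}(x)\gets n!\,y_n/k!$. Counting convention: the basic arithmetic operations are additions, multiplications and divisions. The factorials $2!,\ldots,n!$ are computed once by successive multiplication ($n-1$ multiplications; $k!$ is among them), step 1 then uses one division per entry ($n+\sigma-\sum_{m=1}^\sigma p_m$ divisions), and step 3 uses one multiplication and one division. The numbers $r_1,\ldots,r_\sigma$ are computed as the partial sums of $p_1,p_2,\ldots,p_\sigma$ using $\sigma-1$ additions in total. Each sum of $N$ products in step 2(c) costs $N$ multiplications and $N-1$ additions, i.e. $2N-1$ operations (also when some factors are $0$ or $1$). Assignments, initializations, and all other computations of loop bounds and array indices are free. The cost of factorizing $k$ is not counted. *)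

theory Defs
  imports Complex_Main "HOL-Library.FuncSet" "HOL-Library.State_Monad"
begin

definition bell_poly :: "nat \<Rightarrow> nat \<Rightarrow> (nat \<Rightarrow> real) \<Rightarrow> real" where
  "bell_poly n k x =
     (\<Sum>j | j \<in> {1..n} \<rightarrow>\<^sub>E (UNIV :: nat set) \<and> (\<Sum>i=1..n. j i) = k \<and> (\<Sum>i=1..n. i * j i) = n.
        fact n / (\<Prod>i=1..n. fact (j i)) * (\<Prod>i=1..n. (x i / fact i) ^ j i))"

text \<open>
  A computation of type \<open>'a counted\<close> carries a counter of the basic arithmetic operations
  executed so far. Only the three operations below increment it; everything not routed through
  them (assignments, loop bounds, array indices) is free.
\<close>

type_synonym 'a counted = "(nat, 'a) state"

definition op_add :: "'a::plus \<Rightarrow> 'a \<Rightarrow> 'a counted" where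
  "op_add a b = State (\<lambda>c. (a + b, Suc c))"

definition op_mult :: "'a::times \<Rightarrow> 'a \<Rightarrow> 'a counted" where
  "op_mult a b = State (\<lambda>c. (a * b, Suc c))"

definition op_divide :: "real \<Rightarrow> real \<Rightarrow> real counted" where
  "op_divide a b = State (\<lambda>c. (a / b, Suc c))"

fun for_loop :: "nat list \<Rightarrow> (nat \<Rightarrow> 's \<Rightarrow> 's counted) \<Rightarrow> 's \<Rightarrow> 's counted" where
  "for_loop [] body s = State_Monad.return s"
| "for_loop (i # is) body s = do { s' \<leftarrow> body i s; for_loop is body s' }"

text \<open>
  Arrays are functions on indices. \<open>\<lambda>_. undefined\<close> is an uninitialised array: nothing is
  known about a cell that has not been assigned.
\<close>

definition factorial_table :: "nat \<Rightarrow> (nat \<Rightarrow> real) counted" where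
  "factorial_table n =
     for_loop [2..<Suc n]
       (\<lambda>i f. do { v \<leftarrow> op_mult (real i) (f (i - 1)); State_Monad.return (f(i := v)) })
       ((\<lambda>_. undefined)(1 := 1))"

definition partial_sums :: "nat \<Rightarrow> (nat \<Rightarrow> nat) \<Rightarrow> (nat \<Rightarrow> nat) counted" where
  "partial_sums \<sigma> p =
     for_loop [2..<Suc \<sigma>]
       (\<lambda>s t. do { v \<leftarrow> op_add (t (s - 1)) (p s); State_Monad.return (t(s := v)) })
       ((\<lambda>_. undefined)(1 := p 1))"

text \<open>A sum of \<open>N \<ge> 1\<close> products \<open>u 1 * v 1 + \<dots> + u N * v N\<close>.\<close>

definition sum_of_products :: "nat \<Rightarrow> (nat \<Rightarrow> real) \<Rightarrow> (nat \<Rightarrow> real) \<Rightarrow> real counted" where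
  "sum_of_products N u v = do {
     s \<leftarrow> op_mult (u 1) (v 1);
     for_loop [2..<Suc N] (\<lambda>m s. do { t \<leftarrow> op_mult (u m) (v m); op_add s t }) s
   }"

text \<open>
  One pass of the main loop, for the factor \<open>q = p (\<sigma> - j + 1)\<close> and
  \<open>d = n - r j + \<sigma> - j\<close>; the array \<open>B\<close> holds \<open>B i l\<close> for the partial ordinary
  Bell polynomial with indices \<open>i\<close> and \<open>l\<close>.
\<close>

definition bell_pass ::
  "nat \<Rightarrow> nat \<Rightarrow> (nat \<Rightarrow> real) \<times> (nat \<Rightarrow> nat \<Rightarrow> real) \<Rightarrow> ((nat \<Rightarrow> real) \<times> (nat \<Rightarrow> nat \<Rightarrow> real)) counted"
where
  "bell_pass d q = (\<lambda>(y, B). do {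
     let B0 = (\<lambda>i l. if i = 0 \<and> l = 0 then 1 else if i \<in> {1..d} \<and> l = 0 then 0 else B i l);
     B' \<leftarrow> for_loop [1..<Suc q]
       (\<lambda>l. for_loop [l..<Suc (l + d)]
         (\<lambda>i T. do {
            v \<leftarrow> sum_of_products (i - l + 1) y (\<lambda>m. T (i - m) (l - 1));
            State_Monad.return (T(i := (T i)(l := v)))
          })) B0;
     State_Monad.return
       (\<lambda>l. if l \<in> {1..q - 1} then 0 else if l \<in> {q..d + q} then B' l q else y l, B')
   })"

text \<open>
  The natural-number subtractions below do not truncate as long as \<open>p 1, \<dots>, p \<sigma>\<close> are
  positive with product at most \<open>n\<close>, since then \<open>(\<Sum>m=1..s. p m - 1) \<le> n - 1\<close>
  for every \<open>s \<le> \<sigma>\<close>.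
\<close>

definition algorithm2 ::
  "nat \<Rightarrow> nat \<Rightarrow> nat \<Rightarrow> (nat \<Rightarrow> nat) \<Rightarrow> (nat \<Rightarrow> real) \<Rightarrow> real counted"
where
  "algorithm2 n k \<sigma> p x = do {
     f \<leftarrow> factorial_table n;
     y0 \<leftarrow> for_loop [1..<Suc (n + \<sigma> - (\<Sum>m=1..\<sigma>. p m))]
       (\<lambda>i y. do { v \<leftarrow> op_divide (x i) (f i); State_Monad.return (y(i := v)) })
       (\<lambda>_. undefined);
     P \<leftarrow> partial_sums \<sigma> p;
     (y, B) \<leftarrow> for_loop [1..<Suc \<sigma>]
       (\<lambda>j. let r = P (\<sigma> - j + 1) in bell_pass (n + (\<sigma> - j) - r) (p (\<sigma> - j + 1)))
       (y0, \<lambda>_ _. undefined);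
     t \<leftarrow> op_mult (f n) (y n);
     op_divide t (f k)
   }"

definition result :: "'a counted \<Rightarrow> 'a" where
  "result M = fst (run_state M 0)"

definition op_count :: "'a counted \<Rightarrow> nat" where
  "op_count M = snd (run_state M 0)"

definition coeff_a :: "nat \<Rightarrow> (nat \<Rightarrow> nat) \<Rightarrow> int" where
  "coeff_a \<sigma> p = (\<Sum>j=1..\<sigma>. int (p j))"

definition coeff_b :: "nat \<Rightarrow> (nat \<Rightarrow> nat) \<Rightarrow> int" where
  "coeff_b \<sigma> p = 2 + 2 * (\<Sum>j=1..\<sigma>. (int j - (\<Sum>m=1..j. int (p m))) * int (p j))"

definition coeff_c :: "nat \<Rightarrow> (nat \<Rightarrow> nat) \<Rightarrow> int" where
  "coeff_c \<sigma> p =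
     (\<Sum>j=1..\<sigma>. (int j - (\<Sum>m=1..j. int (p m)))\<^sup>2 * int (p j))
       - (\<Sum>j=1..\<sigma>. int (p j)) + 2 * int \<sigma>"

end

theory Submission
  imports Defs "HOL-Computational_Algebra.Formal_Power_Series"
begin

text \<open>
  Let \<open>F = (\<Sum>i=1..n. x i / i! * X ^ i)\<close>. A pass with factor \<open>q\<close> turns an initial segment of the
  coefficients of a power series \<open>G\<close> with \<open>G $ 0 = 0\<close> into one of the coefficients of \<open>G ^ q\<close>,
  and this segment is longer by \<open>q - 1\<close>. Writing \<open>R s = p 1 + \<dots> + p s\<close>, the array thus holds the
  first \<open>n + s - R s\<close> coefficients of \<open>F ^ (p (s + 1) * \<dots> * p \<sigma>)\<close> before the pass for \<open>p s\<close>, which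
  takes \<open>p s * (1 + 3 + 5 + \<dots>) = p s * (n + s - R s)\<^sup>2\<close> operations. After the last pass the
  \<open>n\<close>-th entry is the \<open>n\<close>-th coefficient of \<open>F ^ k\<close>, and the multinomial theorem identifies it
  with \<open>k! / n!\<close> times the Bell polynomial.
\<close>

unbundle fps_syntax

section \<open>Exact costs of counted computations\<close>

text \<open>A Hoare-style specification with an exact cost. Quantifying over the initial counter
  lets specifications be chained; one cost for all results suffices because no branch depends on a
  real number.\<close>

definition yields :: "'a counted \<Rightarrow> nat \<Rightarrow> ('a \<Rightarrow> bool) \<Rightarrow> bool" where
  "yields M t P \<longleftrightarrow> (\<forall>c. \<exists>v. run_state M c = (v, c + t) \<and> P v)"

lemma yields_return: "P v \<Longrightarrow> yields (State_Monad.return v) 0 P"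
  by (simp add: yields_def)

lemma yields_op_add: "P (a + b) \<Longrightarrow> yields (op_add a b) 1 P"
  by (simp add: yields_def op_add_def)

lemma yields_op_mult: "P (a * b) \<Longrightarrow> yields (op_mult a b) 1 P"
  by (simp add: yields_def op_mult_def)

lemma yields_op_divide: "P (a / b) \<Longrightarrow> yields (op_divide a b) 1 P"
  by (simp add: yields_def op_divide_def)

lemma yields_bind:
  assumes "yields M t P" and "\<And>v. P v \<Longrightarrow> yields (f v) u Q"
  shows "yields (State_Monad.bind M f) (t + u) Q"
  unfolding yields_def
proof
  fix c
  obtain v where v: "run_state M c = (v, c + t)" "P v"
    using assms(1) unfolding yields_def by blast
  obtain w where "run_state (f v) (c + t) = (w, c + t + u)" "Q w"
    using assms(2)[OF v(2)] unfolding yields_def by blast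
  with v show "\<exists>w. run_state (State_Monad.bind M f) c = (w, c + (t + u)) \<and> Q w"
    by (simp add: add.assoc)
qed

lemma yields_weaken:
  assumes "yields M t P" and "\<And>v. P v \<Longrightarrow> Q v" and "t = u"
  shows "yields M u Q"
  using assms unfolding yields_def by blast

lemma yields_map:
  assumes "yields M t P" and "\<And>v. P v \<Longrightarrow> Q (f v)"
  shows "yields (State_Monad.bind M (\<lambda>v. State_Monad.return (f v))) t Q"
proof -
  have "yields (State_Monad.bind M (\<lambda>v. State_Monad.return (f v))) (t + 0) Q"
    using assms by (intro yields_bind[where P = P] yields_return)
  then show ?thesis by simp
qed

lemma yields_result_op_count:
  assumes "yields M t P"
  shows "P (result M)" and "op_count M = t"
  using assms[unfolded yields_def, rule_format, of 0]
  by (auto simp: result_def op_count_def)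

text \<open>\<open>I i\<close> describes the state just before the body runs at index
  \<open>i\<close>. The induction lowers \<open>a\<close> because the loop unfolds at the head of
  its list.\<close>

lemma yields_for_loop:
  assumes "\<And>i s. a \<le> i \<Longrightarrow> i < b \<Longrightarrow> I i s \<Longrightarrow> yields (body i s) (t i) (I (Suc i))"
    and "I a s" and "a \<le> b"
  shows "yields (for_loop [a..<b] body s) (\<Sum>i=a..<b. t i) (I b)"
  using assms(3,1,2)
proof (induction a arbitrary: s rule: inc_induct)
  case base
  then show ?case by (simp add: yields_return)
next
  case (step a)
  have "yields (for_loop [a..<b] body s) (t a + (\<Sum>i=Suc a..<b. t i)) (I b)"
    unfolding upt_conv_Cons[OF step.hyps(2)] for_loop.simps
    by (rule yields_bind[where P = "I (Suc a)"])
       (use step in \<open>auto intro: Suc_leD\<close>)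
  then show ?case
    using step.hyps(2) by (simp add: sum.atLeast_Suc_lessThan)
qed

section \<open>Factorials, partial sums and sums of products\<close>

lemma yields_factorial_table:
  assumes "1 \<le> n"
  shows "yields (factorial_table n) (n - 1) (\<lambda>f. \<forall>i\<in>{1..n}. f i = fact i)"
proof -
  have "yields (factorial_table n) (\<Sum>i=2..<Suc n. 1) (\<lambda>f. \<forall>i\<in>{1..<Suc n}. f i = fact i)"
    unfolding factorial_table_def
  proof (rule yields_for_loop[where I = "\<lambda>i f. \<forall>m\<in>{1..<i}. f m = fact m"])
    fix i :: nat and f :: "nat \<Rightarrow> real"
    assume i: "2 \<le> i" and f: "\<forall>m\<in>{1..<i}. f m = fact m"
    have "real i * f (i - 1) = fact i"
      using i f by (simp add: fact_reduce)
    then show "yields (op_mult (real i) (f (i - 1)) \<bind> (\<lambda>v. State_Monad.return (f(i := v)))) 1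
        (\<lambda>f. \<forall>m\<in>{1..<Suc i}. f m = fact m)"
      by (intro yields_map[where P = "\<lambda>v. v = fact i"] yields_op_mult) (use f in auto)
  qed (use assms in \<open>auto simp: numeral_2_eq_2 less_Suc_eq\<close>)
  then show ?thesis
    by (rule yields_weaken) auto
qed

lemma yields_partial_sums:
  assumes "1 \<le> \<sigma>"
  shows "yields (partial_sums \<sigma> p) (\<sigma> - 1) (\<lambda>P. \<forall>s\<in>{1..\<sigma>}. P s = (\<Sum>m=1..s. p m))"
proof -
  have "yields (partial_sums \<sigma> p) (\<Sum>i=2..<Suc \<sigma>. 1)
      (\<lambda>P. \<forall>s\<in>{1..<Suc \<sigma>}. P s = (\<Sum>m=1..s. p m))"
    unfolding partial_sums_def
  proof (rule yields_for_loop[where I = "\<lambda>i P. \<forall>s\<in>{1..<i}. P s = (\<Sum>m=1..s. p m)"])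
    fix i :: nat and P :: "nat \<Rightarrow> nat"
    assume i: "2 \<le> i" and P: "\<forall>s\<in>{1..<i}. P s = (\<Sum>m=1..s. p m)"
    obtain i' where i': "i = Suc i'" "1 \<le> i'" using i by (cases i) auto
    have "P (i - 1) + p i = (\<Sum>m=1..i. p m)"
      using i' P by simp
    then show "yields (op_add (P (i - 1)) (p i) \<bind> (\<lambda>v. State_Monad.return (P(i := v)))) 1
        (\<lambda>P. \<forall>s\<in>{1..<Suc i}. P s = (\<Sum>m=1..s. p m))"
      by (intro yields_map[where P = "\<lambda>v. v = (\<Sum>m=1..i. p m)"] yields_op_add) (use P in auto)
  qed (use assms in \<open>auto simp: numeral_2_eq_2 less_Suc_eq\<close>)
  then show ?thesis
    by (rule yields_weaken) auto
qed

text \<open>One multiplication for the first product, then a multiplication and an addition for each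
  of the other \<open>N - 1\<close>.\<close>

lemma yields_sum_of_products:
  assumes "1 \<le> N"
  shows "yields (sum_of_products N u v) (2 * N - 1) (\<lambda>s. s = (\<Sum>m=1..N. u m * v m))"
proof -
  have "yields (for_loop [2..<Suc N] (\<lambda>m s. op_mult (u m) (v m) \<bind> op_add s) s)
      (\<Sum>m=2..<Suc N. 1 + 1) (\<lambda>s. s = (\<Sum>m=1..<Suc N. u m * v m))" if "s = u 1 * v 1" for s
  proof (rule yields_for_loop[where I = "\<lambda>i s. s = (\<Sum>m=1..<i. u m * v m)"])
    fix i :: nat and s
    assume "2 \<le> i" "s = (\<Sum>m=1..<i. u m * v m)"
    then show "yields (op_mult (u i) (v i) \<bind> op_add s) (1 + 1)
        (\<lambda>s. s = (\<Sum>m=1..<Suc i. u m * v m))"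
      by (intro yields_bind[where P = "\<lambda>t. t = u i * v i"] yields_op_mult yields_op_add) auto
  qed (use assms that in \<open>auto simp: numeral_2_eq_2\<close>)
  then have "yields (sum_of_products N u v) (1 + (\<Sum>m=2..<Suc N. 1 + 1))
      (\<lambda>s. s = (\<Sum>m=1..<Suc N. u m * v m))"
    unfolding sum_of_products_def
    by (intro yields_bind[where P = "\<lambda>s. s = u 1 * v 1"] yields_op_mult) auto
  then show ?thesis
    by (rule yields_weaken) (use assms in \<open>auto simp: atLeastLessThanSuc_atLeastAtMost\<close>)
qed

section \<open>One pass: powers of a power series\<close>

text \<open>In the Cauchy product for \<open>G * G ^ l\<close> the term \<open>m = 0\<close>
  vanishes because \<open>G $ 0 = 0\<close>, and those with \<open>i - m < l\<close> because
  \<open>fps_X ^ l\<close> divides \<open>G ^ l\<close>. What is left is the sum by which a pass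
  gets column \<open>l + 1\<close> from column \<open>l\<close>.\<close>

lemma fps_power_Suc_nth_sum:
  fixes G :: "'a::comm_ring_1 fps"
  assumes "G $ 0 = 0" and "l \<le> i"
  shows "(G ^ Suc l) $ i = (\<Sum>m=1..i-l. G $ m * (G ^ l) $ (i - m))"
proof -
  have "(G ^ Suc l) $ i = (\<Sum>m=0..i. G $ m * (G ^ l) $ (i - m))"
    by (simp add: fps_mult_nth)
  also have "\<dots> = (\<Sum>m=1..i-l. G $ m * (G ^ l) $ (i - m))"
  proof (rule sum.mono_neutral_right)
    show "\<forall>m\<in>{0..i} - {1..i-l}. G $ m * (G ^ l) $ (i - m) = 0"
    proof
      fix m assume "m \<in> {0..i} - {1..i-l}"
      then have "m = 0 \<or> i - m < l" using assms(2) by auto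
      then show "G $ m * (G ^ l) $ (i - m) = 0"
        using assms(1) startsby_zero_power_prefix[OF assms(1), of l] by auto
    qed
  qed auto
  finally show ?thesis .
qed

text \<open>The summands are the costs of the sums of products, of lengths \<open>1\<close> to
  \<open>d + 1\<close>, that fill one column of the table.\<close>

lemma sum_odd_squares: "(\<Sum>i=l..<Suc (l + d). 2 * (i - l + 1) - 1) = (d + 1)\<^sup>2" for l d :: nat
  by (induction d) (auto simp: power2_eq_square)

text \<open>Column \<open>l\<close> receives \<open>d + 1\<close> coefficients of
  \<open>G ^ l\<close>, beginning at index \<open>l\<close>. It depends only on \<open>y\<close> and
  the previous column, so nothing is required of the old contents \<open>B\<close>.\<close>

lemma yields_bell_pass:
  assumes G0: "G $ 0 = 0" and y: "\<And>m. m \<in> {1..Suc d} \<Longrightarrow> y m = G $ m" and "0 < q"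
  shows "yields (bell_pass d q (y, B)) (q * (d + 1)\<^sup>2)
    (\<lambda>(y', B'). \<forall>i\<in>{1..d + q}. y' i = (G ^ q) $ i)"
proof -
  \<comment> \<open>The window starts at \<open>l\<close> since lower coefficients of
    \<open>G ^ l\<close> vanish; cells outside it may hold anything and are never read.\<close>
  define J where "J l T \<longleftrightarrow> (\<forall>i\<in>{l..l + d}. T i l = (G ^ l) $ i)"
    for l and T :: "nat \<Rightarrow> nat \<Rightarrow> real"
  define body where "body l i T = do {
      v \<leftarrow> sum_of_products (i - l + 1) y (\<lambda>m. T (i - m) (l - 1));
      State_Monad.return (T(i := (T i)(l := v))) }" for l i and T :: "nat \<Rightarrow> nat \<Rightarrow> real"
  define B0 where "B0 = (\<lambda>i l. if i = 0 \<and> l = 0 then 1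
      else if i \<in> {1..d} \<and> l = 0 then 0 else B i l)"
  have inner: "yields (for_loop [l..<Suc (l + d)] (body l) T) ((d + 1)\<^sup>2) (J l)"
    if l: "1 \<le> l" and T: "J (l - 1) T" for l T
  proof -
    obtain l' where l': "l = Suc l'" using l by (cases l) auto
    have "yields (for_loop [l..<Suc (l + d)] (body l) T)
        (\<Sum>i=l..<Suc (l + d). 2 * (i - l + 1) - 1)
        (\<lambda>T. J l' T \<and> (\<forall>m\<in>{l..<Suc (l + d)}. T m l = (G ^ l) $ m))"
    proof (rule yields_for_loop
        [where I = "\<lambda>i T. J l' T \<and> (\<forall>m\<in>{l..<i}. T m l = (G ^ l) $ m)"])
      fix i T
      assume i: "l \<le> i" "i < Suc (l + d)"
        and T: "J l' T \<and> (\<forall>m\<in>{l..<i}. T m l = (G ^ l) $ m)"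
      have "(\<Sum>m=1..i - l + 1. y m * T (i - m) (l - 1)) =
          (\<Sum>m=1..i - l'. G $ m * (G ^ l') $ (i - m))"
      proof (rule sum.cong)
        fix m assume m: "m \<in> {1..i - l'}"
        \<comment> \<open>Both factors are known: as \<open>m\<close> is at least \<open>1\<close>,
          row \<open>i - m\<close> stays in the window of the previous column, and \<open>m\<close>
          is at most \<open>d + 1\<close>.\<close>
        have "i - m \<in> {l'..l' + d}" "m \<in> {1..Suc d}" using m i l' by auto
        then show "y m * T (i - m) (l - 1) = G $ m * (G ^ l') $ (i - m)"
          using T y l' by (simp add: J_def)
      qed (use i l' in auto)
      also have "\<dots> = (G ^ l) $ i"
        using fps_power_Suc_nth_sum[OF G0, of l' i] i l' by simp
      finally have v: "(\<Sum>m=1..i - l + 1. y m * T (i - m) (l - 1)) = (G ^ l) $ i" .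
      show "yields (body l i T) (2 * (i - l + 1) - 1)
          (\<lambda>T. J l' T \<and> (\<forall>m\<in>{l..<Suc i}. T m l = (G ^ l) $ m))"
        unfolding body_def
        by (rule yields_map[OF yields_sum_of_products])
           (use T v l' in \<open>auto simp: J_def less_Suc_eq\<close>)
    qed (use T l' in auto)
    then show ?thesis
      by (rule yields_weaken) (simp_all only: sum_odd_squares, auto simp: J_def)
  qed
  have "J 0 B0"
    by (auto simp: J_def B0_def)
  then have "yields (for_loop [1..<Suc q] (\<lambda>l. for_loop [l..<Suc (l + d)] (body l)) B0)
      (\<Sum>l=1..<Suc q. (d + 1)\<^sup>2) (\<lambda>T. J (Suc q - 1) T)"
    by (intro yields_for_loop[where I = "\<lambda>l. J (l - 1)"]) (use inner in auto)
  then have outer: "yields (for_loop [1..<Suc q] (\<lambda>l. for_loop [l..<Suc (l + d)] (body l)) B0)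
      (q * (d + 1)\<^sup>2) (J q)"
    by (rule yields_weaken) auto
  \<comment> \<open>This justifies the zeros that the pass stores below index
    \<open>q\<close>.\<close>
  have zero: "(G ^ q) $ i = 0" if "i < q" for i
    using startsby_zero_power_prefix[OF G0, of q] that by blast
  show ?thesis
    unfolding bell_pass_def Let_def case_prod_conv body_def[symmetric] B0_def[symmetric]
    by (rule yields_map[OF outer]) (auto simp: J_def zero)
qed

section \<open>The multinomial theorem and Bell polynomials\<close>

text \<open>Dividing \<open>k choose i\<close> by \<open>k!\<close> leaves
  \<open>1 / (i! * (k - i)!)\<close>. In divided powers \<open>a ^ i / i!\<close> the binomial
  theorem thus has no coefficients, a form that iterates over many summands.\<close>

lemma fps_divided_power_add:
  fixes a b :: "'a::field_char_0 fps"
  shows "fps_const (1 / fact k) * (a + b) ^ k =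
    (\<Sum>i\<le>k. (fps_const (1 / fact i) * a ^ i) * (fps_const (1 / fact (k - i)) * b ^ (k - i)))"
proof -
  have "fps_const (1 / fact k) * (of_nat (k choose i) * a ^ i * b ^ (k - i)) =
     (fps_const (1 / fact i) * a ^ i) * (fps_const (1 / fact (k - i)) * b ^ (k - i))"
    if "i \<le> k" for i
  proof -
    have "fps_const (1 / fact k) * of_nat (k choose i) =
        fps_const (1 / fact i :: 'a) * fps_const (1 / fact (k - i))"
      unfolding fps_of_nat[symmetric] fps_const_mult using that by (simp add: binomial_fact)
    then show ?thesis by (simp add: mult_ac)
  qed
  then show ?thesis
    unfolding binomial_ring sum_distrib_left by (intro sum.cong) auto
qed

lemma finite_PiE_sum_eq:
  assumes "finite A"
  shows "finite {j \<in> A \<rightarrow>\<^sub>E (UNIV :: nat set). sum j A = k}"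
proof (rule finite_subset)
  show "{j \<in> A \<rightarrow>\<^sub>E (UNIV :: nat set). sum j A = k} \<subseteq> A \<rightarrow>\<^sub>E {..k}"
    using member_le_sum[OF _ _ assms] by (fastforce simp: PiE_iff)
  show "finite (A \<rightarrow>\<^sub>E {..k})"
    using assms by (intro finite_PiE) auto
qed

text \<open>The multinomial theorem in divided powers. Induction on \<open>A\<close> splits off the
  exponent \<open>m\<close> of the new summand and leaves the total \<open>k - m\<close> to the
  others.\<close>

lemma fps_divided_power_sum:
  fixes z :: "'b \<Rightarrow> 'a::field_char_0 fps"
  assumes "finite A"
  shows "fps_const (1 / fact k) * (\<Sum>i\<in>A. z i) ^ k =
    (\<Sum>j | j \<in> A \<rightarrow>\<^sub>E (UNIV :: nat set) \<and> sum j A = k.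
       \<Prod>i\<in>A. fps_const (1 / fact (j i)) * z i ^ j i)"
  using assms
proof (induction A arbitrary: k rule: finite_induct)
  case empty
  show ?case
  proof (cases k)
    case 0
    have "{j. j = (\<lambda>x::'b. undefined :: nat)} = {\<lambda>x. undefined}" by auto
    with 0 show ?thesis by simp
  qed simp
next
  case (insert a A)
  define S where "S A k = {j \<in> A \<rightarrow>\<^sub>E (UNIV :: nat set). sum j A = k}" for A :: "'b set" and k
  define w where "w i m = fps_const (1 / fact m) * z i ^ m" for i m
  have "fps_const (1 / fact k) * (\<Sum>i\<in>insert a A. z i) ^ k =
      (\<Sum>m\<le>k. w a m * (\<Sum>g\<in>S A (k - m). \<Prod>i\<in>A. w i (g i)))"
    using insert by (simp add: fps_divided_power_add S_def w_def)
  also have "\<dots> = (\<Sum>(m, g)\<in>Sigma {..k} (\<lambda>m. S A (k - m)). w a m * (\<Prod>i\<in>A. w i (g i)))"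
    unfolding sum_distrib_left
    by (rule sum.Sigma) (use finite_PiE_sum_eq[OF insert.hyps(1)] in \<open>auto simp: S_def\<close>)
  \<comment> \<open>An exponent function on \<open>insert a A\<close> corresponds to its value at
    \<open>a\<close> and its restriction to \<open>A\<close>; resetting \<open>a\<close> to
    \<open>undefined\<close> keeps the restriction extensional.\<close>
  also have "\<dots> = (\<Sum>j\<in>S (insert a A) k. \<Prod>i\<in>insert a A. w i (j i))"
  proof (rule sum.reindex_bij_witness
      [where i = "\<lambda>j. (j a, j(a := undefined))" and j = "\<lambda>(m, g). g(a := m)"])
    fix mg assume mg: "mg \<in> Sigma {..k} (\<lambda>m. S A (k - m))"
    obtain m g where [simp]: "mg = (m, g)" by (cases mg)
    have g: "m \<le> k" "g \<in> A \<rightarrow>\<^sub>E UNIV" "sum g A = k - m" using mg by (auto simp: S_def)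
    have "sum (g(a := m)) A = sum g A"
      using insert.hyps by (intro sum.cong) auto
    then show "(case mg of (m, g) \<Rightarrow> g(a := m)) \<in> S (insert a A) k"
      using g insert.hyps PiE_fun_upd[OF UNIV_I g(2), of a m]
      by (simp add: S_def del: fun_upd_apply) simp
    have "(\<Prod>i\<in>A. w i ((g(a := m)) i)) = (\<Prod>i\<in>A. w i (g i))"
      using insert.hyps by (intro prod.cong) auto
    then show "(\<Prod>i\<in>insert a A. w i ((case mg of (m, g) \<Rightarrow> g(a := m)) i)) =
        (case mg of (m, g) \<Rightarrow> w a m * (\<Prod>i\<in>A. w i (g i)))"
      using insert.hyps by simp
    show "((case mg of (m, g) \<Rightarrow> g(a := m)) a, (case mg of (m, g) \<Rightarrow> g(a := m))(a := undefined)) = mg"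
      using PiE_arb[OF g(2) insert.hyps(2)] by (simp add: fun_upd_idem)
  next
    fix j assume j: "j \<in> S (insert a A) k"
    show "(case (j a, j(a := undefined)) of (m, g) \<Rightarrow> g(a := m)) = j" by simp
    have "sum (j(a := undefined)) A = sum j A"
      using insert.hyps by (intro sum.cong) auto
    then show "(j a, j(a := undefined)) \<in> Sigma {..k} (\<lambda>m. S A (k - m))"
      using j insert.hyps by (auto simp: S_def intro: fun_upd_in_PiE)
  qed
  finally show ?case by (simp add: S_def w_def)
qed

text \<open>The multinomial expansion yields the exponent functions of total \<open>k\<close>, each
  with a monomial in \<open>fps_X\<close>; taking the coefficient at \<open>n\<close> then imposes
  the second constraint in \<open>bell_poly\<close>.\<close>

lemma bell_poly_eq_fps_power:
  "bell_poly n k x = fact n / fact k *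
     ((\<Sum>i=1..n. fps_const (x i / fact i) * fps_X ^ i) ^ k) $ n"
proof -
  define S where "S = {j \<in> {1..n} \<rightarrow>\<^sub>E (UNIV :: nat set). sum j {1..n} = k}"
  define c where "c j = (\<Prod>i=1..n. (x i / fact i) ^ j i / fact (j i))" for j :: "nat \<Rightarrow> nat"
  have fin: "finite S"
    unfolding S_def by (rule finite_PiE_sum_eq) simp
  have fps_const_prod: "(\<Prod>i\<in>A. fps_const (h i)) = fps_const (\<Prod>i\<in>A. h i)"
    for A :: "nat set" and h :: "nat \<Rightarrow> real"
    by (induction A rule: infinite_finite_induct) simp_all
  have summand: "(\<Prod>i=1..n. fps_const (1 / fact (j i)) * (fps_const (x i / fact i) * fps_X ^ i) ^ j i) =
      fps_const (c j) * fps_X ^ (\<Sum>i=1..n. i * j i)" for j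
  proof -
    have "fps_const (1 / fact (j i)) * (fps_const (x i / fact i) * fps_X ^ i) ^ j i =
        fps_const ((x i / fact i) ^ j i / fact (j i)) * fps_X ^ (i * j i)" for i
      by (simp add: power_mult_distrib fps_const_power power_mult mult.assoc[symmetric])
    then show ?thesis
      by (simp add: prod.distrib fps_const_prod c_def power_sum)
  qed
  have "((\<Sum>i=1..n. fps_const (x i / fact i) * fps_X ^ i) ^ k) $ n / fact k =
      (fps_const (1 / fact k) * (\<Sum>i=1..n. fps_const (x i / fact i) * fps_X ^ i) ^ k) $ n"
    by simp
  also have "\<dots> = (\<Sum>j\<in>S. fps_const (c j) * fps_X ^ (\<Sum>i=1..n. i * j i)) $ n"
    by (simp only: fps_divided_power_sum[OF finite_atLeastAtMost] summand S_def)
  also have "\<dots> = (\<Sum>j\<in>S. if (\<Sum>i=1..n. i * j i) = n then c j else 0)"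
    unfolding fps_sum_nth by (intro sum.cong) auto
  also have "\<dots> = (\<Sum>j | j \<in> S \<and> (\<Sum>i=1..n. i * j i) = n. c j)"
    using fin by (simp add: sum.inter_filter)
  also have "fact n * \<dots> = bell_poly n k x"
    unfolding bell_poly_def sum_distrib_left
    by (intro sum.cong) (auto simp: S_def c_def prod_dividef)
  finally show ?thesis by simp
qed

section \<open>Index bounds that exclude truncated subtraction\<close>

text \<open>For positive \<open>P\<close> and \<open>q\<close> the difference of
  \<open>P * q + 1\<close> and \<open>P + q\<close> is \<open>(P - 1) * (q - 1)\<close>, which
  drives the induction. Adding \<open>s\<close> on the right avoids the subtractions in
  \<open>p m - 1\<close>.\<close>

lemma sum_le_prod_nat:
  fixes p :: "nat \<Rightarrow> nat"
  assumes "\<And>m. m \<in> {1..s} \<Longrightarrow> 0 < p m"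
  shows "(\<Sum>m=1..s. p m) + 1 \<le> (\<Prod>m=1..s. p m) + s"
  using assms
proof (induction s)
  case (Suc s)
  define P where "P = (\<Prod>m=1..s. p m)"
  have "(\<Sum>m=1..s. p m) + 1 \<le> P + s" using Suc unfolding P_def by simp
  moreover have "P > 0" "p (Suc s) > 0" using Suc.prems by (auto simp: P_def intro!: prod_pos)
  then obtain u v where "P = Suc u" "p (Suc s) = Suc v" by (metis gr0_implies_Suc)
  moreover have "(\<Prod>m=1..Suc s. p m) = P * p (Suc s)" by (simp add: P_def)
  ultimately show ?case by simp
qed simp

text \<open>A partial product divides the whole product and so is at most \<open>n\<close>.
  Strictness keeps the number of array entries in use at least \<open>1\<close>.\<close>

lemma sum_lt_add_if_prod_le:
  fixes p :: "nat \<Rightarrow> nat"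
  assumes "s \<le> \<sigma>" and pos: "\<And>m. m \<in> {1..\<sigma>} \<Longrightarrow> 0 < p m" and "(\<Prod>m=1..\<sigma>. p m) \<le> n"
  shows "(\<Sum>m=1..s. p m) < n + s"
proof -
  have "(\<Prod>m=1..s. p m) \<le> (\<Prod>m=1..\<sigma>. p m)"
    using assms(1) by (intro dvd_imp_le prod_dvd_prod_subset prod_pos) (auto intro!: pos)
  moreover have "(\<Sum>m=1..s. p m) + 1 \<le> (\<Prod>m=1..s. p m) + s"
    using assms(1) by (intro sum_le_prod_nat pos) auto
  ultimately show ?thesis
    using assms(3) by simp
qed

section \<open>Correctness and cost of the whole algorithm\<close>

text \<open>The cost lists the phases in program order (factorials, divisions, partial sums, passes,
  last two operations), nested like the chain of binds.\<close>

lemma yields_algorithm2: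
  fixes n k \<sigma> :: nat and p :: "nat \<Rightarrow> nat" and x :: "nat \<Rightarrow> real"
  defines "R \<equiv> \<lambda>s. \<Sum>m=1..s. p m"
  assumes "1 \<le> \<sigma>" and "1 \<le> k" and "k \<le> n"
    and k: "k = (\<Prod>j=1..\<sigma>. p j)"
    and pos: "\<And>j. j \<in> {1..\<sigma>} \<Longrightarrow> 0 < p j"
  shows "yields (algorithm2 n k \<sigma> p x)
      ((n - 1) + ((n + \<sigma> - R \<sigma>) + ((\<sigma> - 1) + ((\<Sum>s=1..\<sigma>. p s * (n + s - R s)\<^sup>2) + 2))))
      (\<lambda>v. v = bell_poly n k x)"
proof -
  define F where "F = (\<Sum>i=1..n. fps_const (x i / fact i) * fps_X ^ i)"
  \<comment> \<open>The exponent reached before the pass for \<open>p s\<close>: round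
    \<open>j\<close> uses \<open>s = \<sigma> - j + 1\<close>, so the factors of larger index are
    already done.\<close>
  define Q where "Q s = (\<Prod>m\<in>{s<..\<sigma>}. p m)" for s
  have R_lt: "R s < n + s" if "s \<le> \<sigma>" for s
    unfolding R_def using sum_lt_add_if_prod_le[of s \<sigma> p n] that pos \<open>k \<le> n\<close> by (simp add: k)
  \<comment> \<open>Hence \<open>n + \<sigma> - R \<sigma>\<close> is at most \<open>n\<close>, and
    the initial divisions read only factorials that the table contains.\<close>
  have R_ge: "s \<le> R s" if "s \<le> \<sigma>" for s
    using that
  proof (induction s)
    case (Suc s)
    then show ?case using pos[of "Suc s"] by (simp add: R_def)
  qed simp
  have F_nth: "F $ i = (if i \<in> {1..n} then x i / fact i else 0)" for i
    by (simp add: F_def fps_sum_nth if_distrib[where f = "\<lambda>t. _ * t"] cong: if_cong)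
  define I where "I s = (\<lambda>(y, B :: nat \<Rightarrow> nat \<Rightarrow> real). \<forall>i\<in>{1..n + s - R s}. y i = (F ^ Q s) $ i)"
    for s
  have init: "yields (for_loop [1..<Suc (n + \<sigma> - (\<Sum>m=1..\<sigma>. p m))]
       (\<lambda>i y. op_divide (x i) (f i) \<bind> (\<lambda>v. State_Monad.return (y(i := v)))) (\<lambda>_. undefined))
       (n + \<sigma> - R \<sigma>) (\<lambda>y. \<forall>i\<in>{1..n + \<sigma> - R \<sigma>}. y i = F $ i)"
    if f: "\<forall>i\<in>{1..n}. f i = fact i" for f
  proof -
    have "yields (for_loop [1..<Suc (n + \<sigma> - R \<sigma>)]
       (\<lambda>i y. op_divide (x i) (f i) \<bind> (\<lambda>v. State_Monad.return (y(i := v)))) (\<lambda>_. undefined))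
       (\<Sum>i=1..<Suc (n + \<sigma> - R \<sigma>). 1) (\<lambda>y. \<forall>i\<in>{1..<Suc (n + \<sigma> - R \<sigma>)}. y i = F $ i)"
    proof (rule yields_for_loop[where I = "\<lambda>i y. \<forall>m\<in>{1..<i}. y m = F $ m"])
      fix i and y :: "nat \<Rightarrow> real"
      assume i: "1 \<le> i" "i < Suc (n + \<sigma> - R \<sigma>)" and y: "\<forall>m\<in>{1..<i}. y m = F $ m"
      have "i \<le> n" using i R_ge[of \<sigma>] by auto
      then have "x i / f i = F $ i" using f i by (simp add: F_nth)
      then show "yields (op_divide (x i) (f i) \<bind> (\<lambda>v. State_Monad.return (y(i := v)))) 1
          (\<lambda>y. \<forall>m\<in>{1..<Suc i}. y m = F $ m)"
        by (intro yields_map[where P = "\<lambda>v. v = F $ i"] yields_op_divide) (use y in auto)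
    qed auto
    then have "yields (for_loop [1..<Suc (n + \<sigma> - R \<sigma>)]
       (\<lambda>i y. op_divide (x i) (f i) \<bind> (\<lambda>v. State_Monad.return (y(i := v)))) (\<lambda>_. undefined))
       (n + \<sigma> - R \<sigma>) (\<lambda>y. \<forall>i\<in>{1..n + \<sigma> - R \<sigma>}. y i = F $ i)"
      by (rule yields_weaken) auto
    then show ?thesis by (simp add: R_def)
  qed
  have pass: "yields (bell_pass (n + (s - 1) - R s) (p s) yB) (p s * (n + s - R s)\<^sup>2) (I (s - 1))"
    if s: "1 \<le> s" "s \<le> \<sigma>" and yB: "I s yB" for s yB
  proof -
    obtain y B where yB_eq: "yB = (y, B)" by (cases yB)
    obtain s' where s': "s = Suc s'" using s by (cases s) auto
    have lt: "R s < n + s" using R_lt s by simp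
    \<comment> \<open>The pass needs as many coefficients as \<open>I s\<close> provides and
      delivers as many as \<open>I (s - 1)\<close> demands. The strict bound \<open>lt\<close>
      excludes truncation in both equations.\<close>
    have d: "n + (s - 1) - R s + 1 = n + s - R s"
      "n + (s - 1) - R s + p s = n + s' - R s'"
      using lt s' by (simp_all add: R_def)
    have "{s'<..\<sigma>} = insert s {s<..\<sigma>}" using s s' by auto
    then have Q: "Q s' = Q s * p s" by (simp add: Q_def)
    \<comment> \<open>A zero exponent would give constant term \<open>1\<close>, but the pass
      requires \<open>0\<close>.\<close>
    have "Q s > 0" unfolding Q_def by (intro prod_pos) (auto intro!: pos)
    then have "(F ^ Q s) $ 0 = 0"
      by (simp add: fps_power_zeroth F_nth)
    then have "yields (bell_pass (n + (s - 1) - R s) (p s) (y, B))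
        (p s * (n + (s - 1) - R s + 1)\<^sup>2)
        (\<lambda>(y', B'). \<forall>i\<in>{1..n + (s - 1) - R s + p s}. y' i = ((F ^ Q s) ^ p s) $ i)"
      by (rule yields_bell_pass) (use yB d(1) pos s in \<open>auto simp: I_def yB_eq\<close>)
    then show ?thesis
      unfolding d yB_eq by (rule yields_weaken) (auto simp: I_def s' Q power_mult[symmetric])
  qed
  have main: "yields (for_loop [1..<Suc \<sigma>]
       (\<lambda>j. let r = P (\<sigma> - j + 1) in bell_pass (n + (\<sigma> - j) - r) (p (\<sigma> - j + 1))) (y, B))
       (\<Sum>s=1..\<sigma>. p s * (n + s - R s)\<^sup>2) (I 0)"
    if P: "\<forall>s\<in>{1..\<sigma>}. P s = (\<Sum>m=1..s. p m)" and y: "\<forall>i\<in>{1..n + \<sigma> - R \<sigma>}. y i = F $ i"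
    for P y B
  proof -
    have "yields (for_loop [1..<Suc \<sigma>]
       (\<lambda>j. let r = P (\<sigma> - j + 1) in bell_pass (n + (\<sigma> - j) - r) (p (\<sigma> - j + 1))) (y, B))
       (\<Sum>j=1..<Suc \<sigma>. p (Suc \<sigma> - j) * (n + (Suc \<sigma> - j) - R (Suc \<sigma> - j))\<^sup>2) (I (Suc \<sigma> - Suc \<sigma>))"
    \<comment> \<open>As \<open>j\<close> runs upwards, the number \<open>Suc \<sigma> - j\<close>
      of remaining factors falls from \<open>\<sigma>\<close> to \<open>0\<close>.\<close>
    proof (rule yields_for_loop[where I = "\<lambda>j. I (Suc \<sigma> - j)"])
      fix j yB assume j: "1 \<le> j" "j < Suc \<sigma>" and yB: "I (Suc \<sigma> - j) yB"
      define s where "s = Suc \<sigma> - j"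
      have s: "1 \<le> s" "s \<le> \<sigma>" "I s yB"
        using j yB by (auto simp: s_def)
      then have P_s: "P s = R s"
        using P by (simp add: R_def)
      have "\<sigma> - j = s - 1" "s - 1 + 1 = s" "Suc \<sigma> - Suc j = s - 1" "Suc \<sigma> - j = s"
        using j by (auto simp: s_def)
      then show "yields ((let r = P (\<sigma> - j + 1) in bell_pass (n + (\<sigma> - j) - r) (p (\<sigma> - j + 1))) yB)
          (p (Suc \<sigma> - j) * (n + (Suc \<sigma> - j) - R (Suc \<sigma> - j))\<^sup>2) (I (Suc \<sigma> - Suc j))"
        unfolding Let_def using pass[OF s] P_s by (simp only:)
    qed (use y in \<open>auto simp: I_def Q_def\<close>)
    moreover have "(\<Sum>j=1..<Suc \<sigma>. p (Suc \<sigma> - j) * (n + (Suc \<sigma> - j) - R (Suc \<sigma> - j))\<^sup>2) =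
        (\<Sum>s=1..\<sigma>. p s * (n + s - R s)\<^sup>2)"
      by (rule sum.reindex_bij_witness[where i = "\<lambda>s. Suc \<sigma> - s" and j = "\<lambda>j. Suc \<sigma> - j"]) auto
    ultimately show ?thesis by simp
  qed
  have "{0<..\<sigma>} = {1..\<sigma>}" by auto
  then have "Q 0 = k" by (simp add: Q_def k)
  then have final: "yields (op_mult (f n) (y n) \<bind> (\<lambda>t. op_divide t (f k))) 2
      (\<lambda>v. v = bell_poly n k x)"
    if f: "\<forall>i\<in>{1..n}. f i = fact i" and yB: "I 0 (y, B)" for f y B
  proof -
    have "y n = (F ^ k) $ n"
      using yB \<open>Q 0 = k\<close> \<open>1 \<le> k\<close> \<open>k \<le> n\<close> by (simp add: I_def R_def)
    then have "f n * y n / f k = bell_poly n k x"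
      using f \<open>1 \<le> k\<close> \<open>k \<le> n\<close> by (simp add: bell_poly_eq_fps_power F_def)
    then have "yields (op_mult (f n) (y n) \<bind> (\<lambda>t. op_divide t (f k))) (1 + 1)
        (\<lambda>v. v = bell_poly n k x)"
      by (intro yields_bind[where P = "\<lambda>t. t = f n * y n"] yields_op_mult yields_op_divide) auto
    then show ?thesis by (simp only: one_add_one)
  qed
  show ?thesis
    unfolding algorithm2_def
    apply (rule yields_bind[OF yields_factorial_table])
    subgoal using assms by simp
    apply (rule yields_bind[OF init], assumption)
    apply (rule yields_bind[OF yields_partial_sums[OF \<open>1 \<le> \<sigma>\<close>]])
    apply (rule yields_bind[OF main], assumption, assumption)
    apply (clarify, rule final, assumption, assumption)
    done
qed

section \<open>The closed form of the operation count\<close>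

theorem proposition2:
  fixes n k \<sigma> :: nat and p :: "nat \<Rightarrow> nat" and x :: "nat \<Rightarrow> real"
  assumes "2 \<le> k" and "k \<le> n"
    and "k = (\<Prod>j=1..\<sigma>. p j)"
    and "\<And>j. j \<in> {1..\<sigma>} \<Longrightarrow> 0 < p j"
    and "\<And>i j. 1 \<le> i \<Longrightarrow> i \<le> j \<Longrightarrow> j \<le> \<sigma> \<Longrightarrow> p j \<le> p i"
  shows "result (algorithm2 n k \<sigma> p x) = bell_poly n k x \<and>
         int (op_count (algorithm2 n k \<sigma> p x)) =
           coeff_a \<sigma> p * (int n)\<^sup>2 + coeff_b \<sigma> p * int n + coeff_c \<sigma> p"
proof -
  define R where "R s = (\<Sum>m=1..s. p m)" for s
  have "1 \<le> \<sigma>"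
    using assms(1,3) by (cases \<sigma>) auto
  have R_le: "R s \<le> n + s" if "s \<le> \<sigma>" for s
    unfolding R_def using sum_lt_add_if_prod_le[of s \<sigma> p n] that assms(2-4) by (simp add: less_imp_le)
  have run: "yields (algorithm2 n k \<sigma> p x)
      ((n - 1) + ((n + \<sigma> - R \<sigma>) + ((\<sigma> - 1) + ((\<Sum>s=1..\<sigma>. p s * (n + s - R s)\<^sup>2) + 2))))
      (\<lambda>v. v = bell_poly n k x)"
    unfolding R_def using \<open>1 \<le> \<sigma>\<close> assms by (intro yields_algorithm2) auto
  \<comment> \<open>By \<open>R_le\<close> the truncated difference is a true one; its square is
    then expanded in powers of \<open>n\<close>.\<close>
  have "int (\<Sum>s=1..\<sigma>. p s * (n + s - R s)\<^sup>2) =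
      (\<Sum>s=1..\<sigma>. int (p s) * (int n + (int s - int (R s)))\<^sup>2)"
    unfolding of_nat_sum by (intro sum.cong) (use R_le in \<open>auto simp: of_nat_diff algebra_simps\<close>)
  also have "\<dots> = (\<Sum>s=1..\<sigma>. int (p s)) * (int n)\<^sup>2 +
      2 * (\<Sum>s=1..\<sigma>. (int s - int (R s)) * int (p s)) * int n +
      (\<Sum>s=1..\<sigma>. (int s - int (R s))\<^sup>2 * int (p s))"
    unfolding sum_distrib_left sum_distrib_right sum.distrib[symmetric]
    by (intro sum.cong) (auto simp: power2_eq_square algebra_simps)
  \<comment> \<open>The other phases cost \<open>2 * n + 2 * \<sigma> - R \<sigma>\<close>, which
    supplies the \<open>2\<close> in \<open>coeff_b\<close> and the last two terms of
    \<open>coeff_c\<close>.\<close>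
  finally show ?thesis
    using yields_result_op_count[OF run] \<open>1 \<le> \<sigma>\<close> assms(1,2) R_le[of \<sigma>]
    by (simp add: coeff_a_def coeff_b_def coeff_c_def R_def of_nat_diff algebra_simps)
qed

end
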